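(* There exist finitely generated, condensed groups that are solvable of step $3$ (i.e., solvable of derived length $3$).
   Context: Space of marked groups: for $n\in\mathbb{N}$, $\mathcal{G}_n$ is the set of pairs $(G,A)$, where $G$ is a group and $A=(a_1,\dots,a_n)$ is an ordered $n$-tuple generating $G$, modulo identifying $(G,(a_1,\dots,a_n))$ with $(H,(b_1,\dots,b_n))$ whenever $a_i\mapsto b_i$ ($i=1,\dots,n$) extends to an isomorphism $G\to H$. For $r\in\mathbb{N}$ write $(G,A)\approx_r(H,B)$ (for elements of $\mathcal{G}_n$) if there is an isomorphism of directed graphs, taking identity to identity, between the balls of radius $r$ around the identity in the Cayley graphs $\Gamma(G,A)$ and $\Gamma(H,B)$ that takes edges labeled by $a_i$ to edges labeled by $b_i$ for all $i$ (the ball of radius $r$ consists of all vertices at distance at most $r$ from the identity and all edges with at least one end at distance at most $r-1$). The sets $\{(H,B)\in\mathcal{G}_n\mid (H,B)\approx_r(G,A)\}$ form a base of the topology of $\mathcal{G}_n$. Identifying $(G,(a_1,\dots,a_n))$ with $(G,(a_1,\dots,a_n,1))$ embeds $\mathcal{G}_n$ in $\mathcal{G}_{n+1}$ as a clopen subset, and $\mathcal{G}=\bigcup_{n}\mathcal{G}_n$ is the topological union; it is a Polish space. For a finitely generated group $G$, $[G]=\{(H,B)\in\mathcal{G}\mid H\cong G\}$. A finitely generated group $G$ is condensed if $[G]$ is non-discrete (as a subspace of $\mathcal{G}$). *)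

theory Defs
  imports
    "HOL-Analysis.Abstract_Topology"
    "HOL-Library.Extended_Nat"
    "HOL-Algebra.Solvable_Groups"
    "Graph_Theory.Digraph_Isomorphism"
begin

section \<open>Finite generation and derived length\<close>

definition finitely_generated :: "('a, 'b) monoid_scheme \<Rightarrow> bool" where
  "finitely_generated G \<longleftrightarrow>
     (\<exists>S. finite S \<and> S \<subseteq> carrier G \<and> generate G S = carrier G)"

text \<open>Meaningful only for solvable groups; otherwise the set below is empty.\<close>

definition derived_length :: "('a, 'b) monoid_scheme \<Rightarrow> nat" where
  "derived_length G = (LEAST n. (derived G ^^ n) (carrier G) = {\<one>\<^bsub>G\<^esub>})"


section \<open>Balls in Cayley graphs\<close>

text \<open>The arc \<open>(g, i)\<close> is the edge from \<open>g\<close> to \<open>g a\<^sub>i\<close> labelled by the \<open>i\<close>-th generator.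
  Generators are labelled by their position in the tuple, so repeated generators give
  parallel edges and trivial generators give loops.\<close>

definition cayley_graph :: "('a, 'b) monoid_scheme \<Rightarrow> 'a list \<Rightarrow> ('a, 'a \<times> nat) pre_digraph" where
  "cayley_graph G A =
     \<lparr> verts = carrier G, arcs = carrier G \<times> {..<length A},
       tail = fst, head = (\<lambda>(g, i). g \<otimes>\<^bsub>G\<^esub> A ! i) \<rparr>"

text \<open>Distances ignore the orientation of edges.\<close>

definition graph_dist :: "('v, 'e) pre_digraph \<Rightarrow> 'v \<Rightarrow> 'v \<Rightarrow> enat" where
  "graph_dist \<Gamma> u v = (INF k \<in> {k. (u, v) \<in> (arcs_ends \<Gamma> \<union> (arcs_ends \<Gamma>)\<inverse>) ^^ k}. enat k)"

text \<open>Distance \<open>< r\<close> is distance at most \<open>r - 1\<close>; in particular the ball of radius \<open>0\<close>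
  has no edges.\<close>

definition graph_ball :: "('v, 'e) pre_digraph \<Rightarrow> 'v \<Rightarrow> nat \<Rightarrow> ('v, 'e) pre_digraph" where
  "graph_ball \<Gamma> u r =
     \<lparr> verts = {v \<in> verts \<Gamma>. graph_dist \<Gamma> u v \<le> enat r},
       arcs = {e \<in> arcs \<Gamma>. graph_dist \<Gamma> u (tail \<Gamma> e) < enat r \<or> graph_dist \<Gamma> u (head \<Gamma> e) < enat r},
       tail = tail \<Gamma>, head = head \<Gamma> \<rparr>"

definition marked_sim :: "nat \<Rightarrow> 'a monoid \<times> 'a list \<Rightarrow> 'a monoid \<times> 'a list \<Rightarrow> bool" where
  "marked_sim r = (\<lambda>(G, A) (H, B).
     let \<Delta> = graph_ball (cayley_graph G A) \<one>\<^bsub>G\<^esub> r;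
         \<Delta>' = graph_ball (cayley_graph H B) \<one>\<^bsub>H\<^esub> r
     in \<exists>f. pre_digraph.digraph_isomorphism \<Delta> f \<and> \<Delta>' = app_iso f \<Delta> \<and>
            iso_verts f \<one>\<^bsub>G\<^esub> = \<one>\<^bsub>H\<^esub> \<and> (\<forall>e \<in> arcs \<Delta>. snd (iso_arcs f e) = snd e))"


section \<open>The space of marked groups\<close>

text \<open>Finitely generated groups are countable, so every marked group is isomorphic to one
  whose carrier is a set of natural numbers.\<close>

type_synonym marked = "nat monoid \<times> nat list"

definition marked_groups :: "marked set" where
  "marked_groups = {(G, A). group G \<and> set A \<subseteq> carrier G \<and> generate G (set A) = carrier G}"

definition marked_iso :: "marked rel" where
  "marked_iso = {((G, A), (H, B)). (G, A) \<in> marked_groups \<and> (H, B) \<in> marked_groups \<and>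
                                   (\<exists>\<phi> \<in> iso G H. map \<phi> A = B)}"

definition marked_space :: "nat \<Rightarrow> marked set set" where
  "marked_space n = {(G, A) \<in> marked_groups. length A = n} // marked_iso"

definition marked_nbhd :: "nat \<Rightarrow> nat \<Rightarrow> marked set \<Rightarrow> marked set set" where
  "marked_nbhd n r X = {Y \<in> marked_space n. \<exists>x \<in> X. \<exists>y \<in> Y. marked_sim r y x}"

definition marked_topology :: "nat \<Rightarrow> marked set topology" where
  "marked_topology n = topology_generated_by {marked_nbhd n r X | r X. X \<in> marked_space n}"

text \<open>The union of the spaces of \<open>n\<close>-generated marked groups along the embeddings that append
  the identity to the tuple: two marked groups are identified if they become isomorphic after
  appending finitely many identities to both.\<close>

definition pad :: "nat \<Rightarrow> marked \<Rightarrow> marked" where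
  "pad k = (\<lambda>(G, A). (G, A @ replicate k \<one>\<^bsub>G\<^esub>))"

definition stable_iso :: "marked rel" where
  "stable_iso = {(x, y). x \<in> marked_groups \<and> y \<in> marked_groups \<and>
                         (\<exists>j k. (pad j x, pad k y) \<in> marked_iso)}"

definition all_marked_space :: "marked set set" where
  "all_marked_space = marked_groups // stable_iso"

text \<open>The canonical map from the \<open>n\<close>-th space into the union sends a class \<open>X\<close> to
  \<open>stable_iso `` X\<close>, the stable class of any of its members.\<close>

definition all_marked_topology :: "marked set topology" where
  "all_marked_topology = topology (\<lambda>U. U \<subseteq> all_marked_space \<and>
     (\<forall>n. openin (marked_topology n) {X \<in> marked_space n. stable_iso `` X \<in> U}))"


section \<open>Condensed groups\<close>

definition iso_class :: "('a, 'b) monoid_scheme \<Rightarrow> marked set set" where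
  "iso_class G = {X \<in> all_marked_space. \<exists>(H, B) \<in> X. H \<cong> G}"

definition condensed :: "('a, 'b) monoid_scheme \<Rightarrow> bool" where
  "condensed G \<longleftrightarrow>
     subtopology all_marked_topology (iso_class G) \<noteq> discrete_topology (iso_class G)"


section \<open>Well-definedness\<close>

lemma length_marked_iso: "((G, A), (H, B)) \<in> marked_iso \<Longrightarrow> length A = length B"
  by (auto simp: marked_iso_def)

lemma equiv_marked_iso: "equiv marked_groups marked_iso"
proof (rule equivI)
  show "marked_iso \<subseteq> marked_groups \<times> marked_groups"
    by (auto simp: marked_iso_def)
  show "refl_on marked_groups marked_iso"
    unfolding refl_on_def
    by (auto simp: marked_iso_def intro!: bexI[OF _ iso_set_refl])
  show "sym marked_iso"
  proof (rule symI, clarify)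
    fix G A H B assume *: "((G, A), (H, B)) \<in> marked_iso"
    then obtain \<phi> where \<phi>: "\<phi> \<in> iso G H" "map \<phi> A = B"
      and m: "(G, A) \<in> marked_groups" "(H, B) \<in> marked_groups"
      by (auto simp: marked_iso_def)
    then have "inv_into (carrier G) \<phi> \<in> iso H G"
      by (auto simp: marked_groups_def intro: group.iso_set_sym)
    moreover have "map (inv_into (carrier G) \<phi>) B = A"
      using \<phi> m by (auto simp: marked_groups_def iso_iff subset_iff intro!: map_idI)
    ultimately show "((H, B), (G, A)) \<in> marked_iso"
      using m by (auto simp: marked_iso_def)
  qed
  show "trans marked_iso"
  proof (rule transI, clarify)
    fix G A H B K C
    assume "((G, A), (H, B)) \<in> marked_iso" "((H, B), (K, C)) \<in> marked_iso"
    then obtain \<phi> \<psi> where *: "\<phi> \<in> iso G H" "\<psi> \<in> iso H K" "map \<phi> A = B" "map \<psi> B = C"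
      and m: "(G, A) \<in> marked_groups" "(K, C) \<in> marked_groups"
      by (auto simp: marked_iso_def)
    have "\<psi> \<circ> \<phi> \<in> iso G K" "map (\<psi> \<circ> \<phi>) A = C"
      using * by (auto intro: iso_set_trans)
    with m show "((G, A), (K, C)) \<in> marked_iso"
      unfolding marked_iso_def by blast
  qed
qed

lemma pad_marked: "x \<in> marked_groups \<Longrightarrow> pad k x \<in> marked_groups"
proof -
  assume x: "x \<in> marked_groups"
  obtain G A where xe: "x = (G, A)" by (cases x)
  have g: "group G" "set A \<subseteq> carrier G" "generate G (set A) = carrier G"
    using x by (auto simp: xe marked_groups_def)
  let ?S = "set A \<union> set (replicate k \<one>\<^bsub>G\<^esub>)"
  have s: "?S \<subseteq> carrier G"
    using g by (auto simp: group.is_monoid[THEN monoid.one_closed])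
  have "carrier G \<subseteq> generate G ?S"
    using g(3) group.mono_generate[OF g(1), of "set A" ?S] by auto
  moreover have "generate G ?S \<subseteq> carrier G"
    using group.generate_incl[OF g(1) s] .
  ultimately show ?thesis
    using g s by (auto simp: xe pad_def marked_groups_def)
qed

lemma pad_pad: "pad j (pad k x) = pad (k + j) x"
  by (cases x) (simp add: pad_def replicate_add)

lemma pad_marked_iso: "(x, y) \<in> marked_iso \<Longrightarrow> (pad k x, pad k y) \<in> marked_iso"
proof -
  assume a: "(x, y) \<in> marked_iso"
  obtain G A H B where e: "x = (G, A)" "y = (H, B)" by (cases x, cases y)
  obtain \<phi> where \<phi>: "\<phi> \<in> iso G H" "map \<phi> A = B"
    and m: "x \<in> marked_groups" "y \<in> marked_groups"
    using a by (auto simp: marked_iso_def e)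
  have "\<phi> \<one>\<^bsub>G\<^esub> = \<one>\<^bsub>H\<^esub>"
    using \<phi> m by (auto simp: e marked_groups_def iso_def intro: hom_one)
  then show ?thesis
    using \<phi> pad_marked[OF m(1), of k] pad_marked[OF m(2), of k]
    by (auto simp: marked_iso_def e pad_def)
qed

lemma equiv_stable_iso: "equiv marked_groups stable_iso"
proof (rule equivI)
  show "stable_iso \<subseteq> marked_groups \<times> marked_groups"
    by (auto simp: stable_iso_def)
  show "refl_on marked_groups stable_iso"
  proof (rule refl_onI)
    fix x assume x: "x \<in> marked_groups"
    have "(pad 0 x, pad 0 x) \<in> marked_iso"
      using equiv_marked_iso pad_marked[OF x] by (meson equiv_def refl_onD)
    then show "(x, x) \<in> stable_iso"
      using x unfolding stable_iso_def by blast
  qed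
  show "sym stable_iso"
    using equiv_marked_iso unfolding stable_iso_def equiv_def sym_def by blast
  show "trans stable_iso"
  proof (rule transI)
    fix x y z assume "(x, y) \<in> stable_iso" "(y, z) \<in> stable_iso"
    then obtain i j k l where ij: "(pad i x, pad j y) \<in> marked_iso"
      and kl: "(pad k y, pad l z) \<in> marked_iso"
      and m: "x \<in> marked_groups" "z \<in> marked_groups"
      by (auto simp: stable_iso_def)
    have "(pad (i + k) x, pad (j + k) y) \<in> marked_iso"
      using pad_marked_iso[OF ij, of k] by (simp add: pad_pad)
    moreover have "(pad (j + k) y, pad (l + j) z) \<in> marked_iso"
      using pad_marked_iso[OF kl, of j] by (simp add: pad_pad add.commute)
    ultimately have "(pad (i + k) x, pad (l + j) z) \<in> marked_iso"
      using equiv_marked_iso by (meson equiv_def transD)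
    then show "(x, z) \<in> stable_iso"
      using m by (auto simp: stable_iso_def)
  qed
qed

lemma openin_all_marked_topology:
  "openin all_marked_topology U \<longleftrightarrow> U \<subseteq> all_marked_space \<and>
     (\<forall>n. openin (marked_topology n) {X \<in> marked_space n. stable_iso `` X \<in> U})"
proof -
  define pre where "pre = (\<lambda>n U. {X \<in> marked_space n. stable_iso `` X \<in> U})"
  have int: "pre n (S \<inter> T) = pre n S \<inter> pre n T" for n S T
    by (auto simp: pre_def)
  have un: "pre n (\<Union>\<K>) = \<Union>(pre n ` \<K>)" for n \<K>
    by (auto simp: pre_def)
  have "istopology (\<lambda>U. U \<subseteq> all_marked_space \<and> (\<forall>n. openin (marked_topology n) (pre n U)))"
    unfolding istopology_def by (auto simp: int un)
  then show ?thesis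
    unfolding all_marked_topology_def pre_def[symmetric]
    using topology_inverse' by (simp add: pre_def)
qed

lemma graph_dist_le_iff:
  "graph_dist \<Gamma> u v \<le> enat r \<longleftrightarrow>
     (\<exists>k\<le>r. (u, v) \<in> (arcs_ends \<Gamma> \<union> (arcs_ends \<Gamma>)\<inverse>) ^^ k)"
proof
  let ?S = "{k. (u, v) \<in> (arcs_ends \<Gamma> \<union> (arcs_ends \<Gamma>)\<inverse>) ^^ k}"
  assume a: "graph_dist \<Gamma> u v \<le> enat r"
  have "?S \<noteq> {}"
  proof (rule notI)
    assume "?S = {}"
    then have "graph_dist \<Gamma> u v = \<infinity>"
      unfolding graph_dist_def by (simp only: image_empty Inf_empty top_enat_def)
    with a show False by simp
  qed
  then obtain k where "k \<in> ?S"
    by blast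
  then have "enat k \<in> enat ` ?S"
    by (rule imageI)
  then have "graph_dist \<Gamma> u v \<in> enat ` ?S"
    unfolding graph_dist_def by (rule wellorder_InfI)
  then obtain m where m: "graph_dist \<Gamma> u v = enat m" "m \<in> ?S"
    by (rule imageE)
  then have "m \<le> r"
    using a by simp
  with m(2) show "\<exists>k\<le>r. (u, v) \<in> (arcs_ends \<Gamma> \<union> (arcs_ends \<Gamma>)\<inverse>) ^^ k"
    by blast
next
  assume "\<exists>k\<le>r. (u, v) \<in> (arcs_ends \<Gamma> \<union> (arcs_ends \<Gamma>)\<inverse>) ^^ k"
  then obtain k where k: "k \<le> r" "(u, v) \<in> (arcs_ends \<Gamma> \<union> (arcs_ends \<Gamma>)\<inverse>) ^^ k"
    by blast
  then have "graph_dist \<Gamma> u v \<le> enat k"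
    unfolding graph_dist_def by (intro INF_lower) simp
  also have "enat k \<le> enat r"
    using k by simp
  finally show "graph_dist \<Gamma> u v \<le> enat r" .
qed

lemma graph_dist_less_Suc: "graph_dist \<Gamma> u v < enat (Suc r) \<longleftrightarrow> graph_dist \<Gamma> u v \<le> enat r"
  by (cases "graph_dist \<Gamma> u v") auto

lemma graph_dist_step:
  assumes "graph_dist \<Gamma> u v < enat r" "(v, w) \<in> arcs_ends \<Gamma> \<union> (arcs_ends \<Gamma>)\<inverse>"
  shows "graph_dist \<Gamma> u w \<le> enat r"
proof (cases r)
  case 0
  with assms show ?thesis by (simp add: zero_enat_def[symmetric])
next
  case (Suc r')
  then obtain k where "k \<le> r'" "(u, v) \<in> (arcs_ends \<Gamma> \<union> (arcs_ends \<Gamma>)\<inverse>) ^^ k"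
    using assms(1) by (auto simp: graph_dist_less_Suc graph_dist_le_iff)
  then have "Suc k \<le> r" "(u, w) \<in> (arcs_ends \<Gamma> \<union> (arcs_ends \<Gamma>)\<inverse>) ^^ Suc k"
    using assms(2) Suc by auto
  then show ?thesis
    unfolding graph_dist_le_iff by blast
qed

lemma wf_graph_ball:
  assumes "wf_digraph \<Gamma>"
  shows "wf_digraph (graph_ball \<Gamma> u r)"
proof -
  interpret wf_digraph \<Gamma> by fact
  have ends: "(tail \<Gamma> e, head \<Gamma> e) \<in> arcs_ends \<Gamma>" if "e \<in> arcs \<Gamma>" for e
    using that by (auto simp: arcs_ends_conv)
  show ?thesis
    using ends by unfold_locales
      (auto simp: graph_ball_def intro: graph_dist_step less_imp_le)
qed

lemma wf_cayley_graph:
  assumes "group G" "set A \<subseteq> carrier G"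
  shows "wf_digraph (cayley_graph G A)"
proof -
  interpret group G by fact
  have "A ! i \<in> carrier G" if "i < length A" for i
    using that assms(2) nth_mem by blast
  then show ?thesis
    by unfold_locales (auto simp: cayley_graph_def)
qed

lemma marked_sim_refl: "x \<in> marked_groups \<Longrightarrow> marked_sim r x x"
proof -
  assume x: "x \<in> marked_groups"
  obtain G A where e: "x = (G, A)" by (cases x)
  define \<Delta> where "\<Delta> = graph_ball (cayley_graph G A) \<one>\<^bsub>G\<^esub> r"
  let ?f = "\<lparr> iso_verts = id, iso_arcs = id, iso_head = head \<Delta>, iso_tail = tail \<Delta> \<rparr>"
  have "wf_digraph \<Delta>"
    using x unfolding \<Delta>_def by (auto simp: e marked_groups_def intro!: wf_graph_ball wf_cayley_graph)
  then have "pre_digraph.digraph_isomorphism \<Delta> ?f" "\<Delta> = app_iso ?f \<Delta>"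
    by (auto simp: pre_digraph.digraph_isomorphism_def app_iso_def)
  then show ?thesis
    unfolding e marked_sim_def Let_def prod.case \<Delta>_def[symmetric]
    by (intro exI[of _ ?f]) simp
qed

lemma topspace_marked_topology: "topspace (marked_topology n) = marked_space n"
proof
  show "topspace (marked_topology n) \<subseteq> marked_space n"
    unfolding marked_topology_def topology_generated_by_topspace marked_nbhd_def by blast
  show "marked_space n \<subseteq> topspace (marked_topology n)"
  proof
    fix X assume X: "X \<in> marked_space n"
    then obtain x where x: "x \<in> marked_groups" "X = marked_iso `` {x}"
      unfolding marked_space_def quotient_def by blast
    then have "x \<in> X"
      using equiv_class_self[OF equiv_marked_iso] by blast
    then have "X \<in> marked_nbhd n 0 X"
      using X marked_sim_refl[OF x(1)] unfolding marked_nbhd_def by blast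
    then show "X \<in> topspace (marked_topology n)"
      using X unfolding marked_topology_def topology_generated_by_topspace by blast
  qed
qed

lemma stable_class_in_all_marked_space:
  assumes "X \<in> marked_space n"
  shows "stable_iso `` X \<in> all_marked_space"
proof -
  obtain x where x: "x \<in> marked_groups" "X = marked_iso `` {x}"
    using assms unfolding marked_space_def quotient_def by blast
  have sub: "(x, y) \<in> stable_iso" if "y \<in> X" for y
  proof -
    have "(pad 0 x, pad 0 y) \<in> marked_iso" "y \<in> marked_groups"
      using that x by (auto simp: pad_def marked_iso_def)
    then show ?thesis
      using x unfolding stable_iso_def by blast
  qed
  have "x \<in> X"
    using x equiv_class_self[OF equiv_marked_iso] by blast
  then have "stable_iso `` X = stable_iso `` {x}"
    using sub equiv_stable_iso unfolding equiv_def trans_def by blast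
  then show ?thesis
    using x unfolding all_marked_space_def quotient_def by blast
qed

lemma topspace_all_marked_topology: "topspace all_marked_topology = all_marked_space"
proof -
  have "{X \<in> marked_space n. stable_iso `` X \<in> all_marked_space} = topspace (marked_topology n)" for n
    by (auto simp: topspace_marked_topology stable_class_in_all_marked_space)
  then have "openin all_marked_topology all_marked_space"
    by (simp add: openin_all_marked_topology)
  then show ?thesis
    by (meson openin_all_marked_topology openin_subset openin_topspace subset_antisym)
qed

end

theory Submission
  imports Defs "HOL-Analysis.Abstract_Limits" "HOL-Library.Poly_Mapping" "HOL-Algebra.Weak_Morphisms"
begin

text \<open>A variant of P. Hall's centre-by-metabelian groups. Let \<open>R\<close> be the ring of integral Laurent
  polynomials in \<open>t\<close>. In the Heisenberg group over \<open>R\<close>, extended by \<open>t\<close> acting on the off-diagonal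
  entries by \<open>a \<mapsto> t a\<close> and \<open>b \<mapsto> t\<^sup>-\<^sup>1 b\<close>, the corner entries form a central subgroup \<open>R\<close>; a function
  \<open>\<phi> : \<int> \<rightarrow> \<int>\<close> defines a homomorphism \<open>R \<rightarrow> \<int>\<close>, \<open>t\<^sup>i \<mapsto> \<phi>(i)\<close>, and pushing out the centre along it
  gives a group \<open>G\<^sub>\<phi>\<close> marked by \<open>t\<close>, \<open>x\<close>, \<open>y\<close> with \<open>[t\<^sup>i x t\<^sup>-\<^sup>i, y] = z\<^sup>\<phi>\<^sup>(\<^sup>i\<^sup>)\<close>. Replacing \<open>x\<close> by
  \<open>t\<^sup>k x t\<^sup>-\<^sup>k\<close> shows that shifting \<open>\<phi>\<close> by \<open>k\<close> does not change \<open>G\<^sub>\<phi>\<close> up to isomorphism, but it changes the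
  marked group unless \<open>\<phi>\<close> is \<open>k\<close>-periodic, while the ball of radius \<open>r\<close> depends only on \<open>\<phi>\<close> on
  \<open>[-2r, 2r]\<close>. A function \<open>\<phi>\<close> that is not periodic but is a pointwise limit of its shifts therefore
  makes the marked group a limit of other markings of \<open>G\<^sub>\<phi>\<close>.\<close>

section \<open>Convergence of marked groups\<close>

abbreviation cayley_adj :: "('a, 'b) monoid_scheme \<Rightarrow> 'a list \<Rightarrow> 'a rel" where
  "cayley_adj G A \<equiv> arcs_ends (cayley_graph G A) \<union> (arcs_ends (cayley_graph G A))\<inverse>"

lemma cayley_adj_iff:
  "(u, v) \<in> cayley_adj G A \<longleftrightarrow>
     (\<exists>i<length A. u \<in> carrier G \<and> v = u \<otimes>\<^bsub>G\<^esub> A ! i \<or> v \<in> carrier G \<and> u = v \<otimes>\<^bsub>G\<^esub> A ! i)"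
  by (auto simp: arcs_ends_def arc_to_ends_def cayley_graph_def image_iff)

text \<open>\<open>P k\<close> is any set containing the ball of radius \<open>k\<close>, so that \<open>h\<close> has to respect the
  generators only there.\<close>

lemma marked_sim_local:
  assumes "group G" "group H" and A: "set A \<subseteq> carrier G" and B: "set B \<subseteq> carrier H"
    and len: "length B = length A"
    and h: "bij_betw h (carrier G) (carrier H)" and h1: "h \<one>\<^bsub>G\<^esub> = \<one>\<^bsub>H\<^esub>"
    and P0: "\<one>\<^bsub>G\<^esub> \<in> P 0" and Pmono: "\<And>k. P k \<subseteq> P (Suc k)"
    and Pout: "\<And>k g i. g \<in> carrier G \<Longrightarrow> i < length A \<Longrightarrow> g \<in> P k \<Longrightarrow> g \<otimes>\<^bsub>G\<^esub> A ! i \<in> P (Suc k)"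
    and Pin: "\<And>k g i. g \<in> carrier G \<Longrightarrow> i < length A \<Longrightarrow> g \<otimes>\<^bsub>G\<^esub> A ! i \<in> P k \<Longrightarrow> g \<in> P (Suc k)"
    and hm: "\<And>g i. g \<in> carrier G \<Longrightarrow> i < length A \<Longrightarrow> g \<in> P r \<Longrightarrow>
                h (g \<otimes>\<^bsub>G\<^esub> A ! i) = h g \<otimes>\<^bsub>H\<^esub> B ! i"
  shows "marked_sim r (G, A) (H, B)"
proof -
  interpret G: group G by fact
  interpret H: group H by fact
  have Ac: "A ! i \<in> carrier G" if "i < length A" for i
    using that A nth_mem by blast
  have Bc: "B ! i \<in> carrier H" if "i < length A" for i
    using that B len nth_mem by (metis subsetD)
  have hc: "h g \<in> carrier H" if "g \<in> carrier G" for g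
    using that h by (auto simp: bij_betw_def)
  have hinj: "g = g'" if "h g = h g'" "g \<in> carrier G" "g' \<in> carrier G" for g g'
    using that h by (auto simp: bij_betw_def inj_on_def)
  have Ple: "P k \<subseteq> P l" if "k \<le> l" for k l
    using that Pmono by (rule lift_Suc_mono_le[of P, rotated])
  \<comment> \<open>Edges of \<open>H\<close> are pulled back to \<open>G\<close>: the source
    \<open>u A_i^-1\<close> lies in \<open>P (Suc k)\<close> by \<open>Pin\<close>, so
    \<open>hm\<close> applies to it, and cancellation in \<open>H\<close> with injectivity of
    \<open>h\<close> identifies it with \<open>g\<close>.\<close>
  have reflect: "u = g \<otimes>\<^bsub>G\<^esub> A ! i \<and> g \<in> P (Suc k)"
    if "u \<in> carrier G" "u \<in> P k" "Suc k \<le> r" "g \<in> carrier G" "i < length A"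
      "h g \<otimes>\<^bsub>H\<^esub> B ! i = h u" for u g i k
  proof -
    define g' where "g' = u \<otimes>\<^bsub>G\<^esub> inv\<^bsub>G\<^esub> (A ! i)"
    have g': "g' \<in> carrier G" "u = g' \<otimes>\<^bsub>G\<^esub> A ! i"
      using that Ac[of i] by (auto simp: g'_def G.m_assoc)
    have g'P: "g' \<in> P (Suc k)"
      using Pin[of g' i k] g' that by simp
    then have "g' \<in> P r" using Ple that by blast
    then have "h u = h g' \<otimes>\<^bsub>H\<^esub> B ! i"
      using hm g' that by simp
    then have "h g' = h g"
      using that hc g' Bc[of i] H.right_cancel by metis
    then show ?thesis
      using hinj g' that g'P by blast
  qed
  define E where "E = cayley_adj G A"
  define F where "F = cayley_adj H B"
  have Fc: "v \<in> carrier H" if "(u, v) \<in> F" for u v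
    using that Bc len unfolding F_def cayley_adj_iff by auto
  have Ec: "v \<in> carrier G" if "(u, v) \<in> E" for u v
    using that Ac unfolding E_def cayley_adj_iff by auto
  have step: "(h u, h g) \<in> F \<longleftrightarrow> (u, g) \<in> E" and stepP: "(u, g) \<in> E \<Longrightarrow> g \<in> P (Suc k)"
    if "u \<in> carrier G" "g \<in> carrier G" "u \<in> P k" "Suc k \<le> r" for u g k
  proof -
    have u: "u \<in> P r" using that Ple by (meson Suc_leD subsetD)
    show P: "g \<in> P (Suc k)" if "(u, g) \<in> E"
      using that \<open>u \<in> P k\<close> Pin Pout unfolding E_def cayley_adj_iff by metis
    show "(h u, h g) \<in> F \<longleftrightarrow> (u, g) \<in> E"
    proof
      assume "(u, g) \<in> E"
      moreover from P[OF this] have "g \<in> P r" using Ple that by blast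
      ultimately show "(h u, h g) \<in> F"
        using u that hm hc len unfolding E_def F_def cayley_adj_iff by metis
    next
      assume "(h u, h g) \<in> F"
      then obtain i where i: "i < length A"
        and c: "h g = h u \<otimes>\<^bsub>H\<^esub> B ! i \<or> h u = h g \<otimes>\<^bsub>H\<^esub> B ! i"
        using len unfolding F_def cayley_adj_iff by auto
      from c have "g = u \<otimes>\<^bsub>G\<^esub> A ! i \<or> u = g \<otimes>\<^bsub>G\<^esub> A ! i"
      proof
        assume "h g = h u \<otimes>\<^bsub>H\<^esub> B ! i"
        then have "h g = h (u \<otimes>\<^bsub>G\<^esub> A ! i)" using hm[of u i] i that u by simp
        then show ?thesis using hinj that Ac[OF i] by blast
      next
        assume "h u = h g \<otimes>\<^bsub>H\<^esub> B ! i"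
        then show ?thesis using reflect[of u k g i] that i by simp
      qed
      then show "(u, g) \<in> E"
        using i that unfolding E_def cayley_adj_iff by blast
    qed
  qed
  \<comment> \<open>Both claims need one induction: \<open>step\<close> transfers an edge only if
    its start is known to lie in \<open>P k\<close> with \<open>Suc k \<le> r\<close>.\<close>
  have reach: "((\<one>\<^bsub>H\<^esub>, h g) \<in> F ^^ k \<longleftrightarrow> (\<one>\<^bsub>G\<^esub>, g) \<in> E ^^ k) \<and> ((\<one>\<^bsub>G\<^esub>, g) \<in> E ^^ k \<longrightarrow> g \<in> P k)"
    if "k \<le> r" "g \<in> carrier G" for k g
    using that
  proof (induction k arbitrary: g)
    case 0
    then show ?case using h1 P0 hinj[of "\<one>\<^bsub>G\<^esub>" g] by auto
  next
    case (Suc k)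
    have Ec: "u \<in> carrier G" if "(\<one>\<^bsub>G\<^esub>, u) \<in> E ^^ k" for u
      using that by (cases k) (auto dest: Ec)
    have Fc: "w \<in> carrier H" if "(\<one>\<^bsub>H\<^esub>, w) \<in> F ^^ k" for w
      using that by (cases k) (auto dest: Fc)
    have k: "k \<le> r" using Suc.prems by simp
    show ?case
    proof (intro conjI iffI impI)
      assume "(\<one>\<^bsub>H\<^esub>, h g) \<in> F ^^ Suc k"
      then obtain w where w: "(\<one>\<^bsub>H\<^esub>, w) \<in> F ^^ k" "(w, h g) \<in> F" by auto
      then obtain u where u: "u \<in> carrier G" "w = h u"
        using Fc h by (auto simp: bij_betw_def)
      have "(\<one>\<^bsub>G\<^esub>, u) \<in> E ^^ k" "u \<in> P k" using Suc.IH[OF k u(1)] w u by auto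
      moreover have "(u, g) \<in> E"
        using step[of u g k] calculation u w Suc.prems by blast
      ultimately show "(\<one>\<^bsub>G\<^esub>, g) \<in> E ^^ Suc k" by auto
    next
      assume "(\<one>\<^bsub>G\<^esub>, g) \<in> E ^^ Suc k"
      then obtain u where u: "(\<one>\<^bsub>G\<^esub>, u) \<in> E ^^ k" "(u, g) \<in> E" by auto
      then have uc: "u \<in> carrier G" using Ec by blast
      have "(\<one>\<^bsub>H\<^esub>, h u) \<in> F ^^ k" "u \<in> P k" using Suc.IH[OF k uc] u by auto
      then show "(\<one>\<^bsub>H\<^esub>, h g) \<in> F ^^ Suc k"
        using step[of u g k] uc u Suc.prems by auto
    next
      assume "(\<one>\<^bsub>G\<^esub>, g) \<in> E ^^ Suc k"
      then obtain u where u: "(\<one>\<^bsub>G\<^esub>, u) \<in> E ^^ k" "(u, g) \<in> E" by auto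
      then have uc: "u \<in> carrier G" using Ec by blast
      then show "g \<in> P (Suc k)"
        using stepP[of u g k] Suc.IH[OF k uc] u Suc.prems by auto
    qed
  qed
  define \<Delta> where "\<Delta> = graph_ball (cayley_graph G A) \<one>\<^bsub>G\<^esub> r"
  define \<Delta>' where "\<Delta>' = graph_ball (cayley_graph H B) \<one>\<^bsub>H\<^esub> r"
  have dist: "graph_dist (cayley_graph H B) \<one>\<^bsub>H\<^esub> (h g) \<le> enat k \<longleftrightarrow>
      graph_dist (cayley_graph G A) \<one>\<^bsub>G\<^esub> g \<le> enat k"
    if "k \<le> r" "g \<in> carrier G" for g k
    using reach that unfolding graph_dist_le_iff E_def F_def
    by (meson dual_order.trans)
  have distP: "\<exists>k. Suc k \<le> r \<and> g \<in> P k"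
    if "graph_dist (cayley_graph G A) \<one>\<^bsub>G\<^esub> g < enat r" "g \<in> carrier G" for g
  proof (cases r)
    case 0
    then show ?thesis using that by (simp add: zero_enat_def[symmetric])
  next
    case (Suc r')
    have "\<exists>k\<le>r'. (\<one>\<^bsub>G\<^esub>, g) \<in> E ^^ k"
      using that(1) unfolding E_def Suc graph_dist_less_Suc graph_dist_le_iff .
    then obtain k where "k \<le> r'" "(\<one>\<^bsub>G\<^esub>, g) \<in> E ^^ k"
      by blast
    then show ?thesis using reach[of k g] that Suc by (intro exI[of _ k]) auto
  qed
  have distl: "graph_dist (cayley_graph H B) \<one>\<^bsub>H\<^esub> (h g) < enat r \<longleftrightarrow>
      graph_dist (cayley_graph G A) \<one>\<^bsub>G\<^esub> g < enat r" if "g \<in> carrier G" for g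
  proof (cases r)
    case 0
    then show ?thesis by (simp add: zero_enat_def[symmetric])
  next
    case (Suc r')
    then show ?thesis using dist[of r' g] that by (simp add: graph_dist_less_Suc)
  qed
  let ?dG = "graph_dist (cayley_graph G A) \<one>\<^bsub>G\<^esub>"
  let ?dH = "graph_dist (cayley_graph H B) \<one>\<^bsub>H\<^esub>"
  have hedge: "h (g \<otimes>\<^bsub>G\<^esub> A ! i) = h g \<otimes>\<^bsub>H\<^esub> B ! i"
    if "g \<in> carrier G" "i < length A" "?dG g < enat r \<or> ?dG (g \<otimes>\<^bsub>G\<^esub> A ! i) < enat r" for g i
  proof -
    have "g \<in> P r"
      using that(3)
    proof
      assume "?dG g < enat r"
      then show ?thesis using distP[of g] that Ple by (meson Suc_leD subsetD)
    next
      assume "?dG (g \<otimes>\<^bsub>G\<^esub> A ! i) < enat r"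
      then show ?thesis using distP[of "g \<otimes>\<^bsub>G\<^esub> A ! i"] that Ac[of i] Pin[of g i] Ple
        by (meson G.m_closed subsetD)
    qed
    then show ?thesis using hm that by blast
  qed
  have arc: "?dH (h g) < enat r \<or> ?dH (h g \<otimes>\<^bsub>H\<^esub> B ! i) < enat r \<longleftrightarrow>
      ?dG g < enat r \<or> ?dG (g \<otimes>\<^bsub>G\<^esub> A ! i) < enat r"
    if gi: "g \<in> carrier G" "i < length A" for g i
  proof
    assume "?dG g < enat r \<or> ?dG (g \<otimes>\<^bsub>G\<^esub> A ! i) < enat r"
    then show "?dH (h g) < enat r \<or> ?dH (h g \<otimes>\<^bsub>H\<^esub> B ! i) < enat r"
      using hedge[OF gi] distl[of g] distl[of "g \<otimes>\<^bsub>G\<^esub> A ! i"] gi Ac[of i] by auto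
  next
    assume "?dH (h g) < enat r \<or> ?dH (h g \<otimes>\<^bsub>H\<^esub> B ! i) < enat r"
    then show "?dG g < enat r \<or> ?dG (g \<otimes>\<^bsub>G\<^esub> A ! i) < enat r"
    proof
      \<comment> \<open>Only the head in \<open>H\<close> is known to be near, so
        \<open>hedge\<close> is not yet available; the preimage \<open>u\<close> of the head is
        near, and \<open>reflect\<close> shows that the edge to it starts at
        \<open>g\<close>.\<close>
      assume d: "?dH (h g \<otimes>\<^bsub>H\<^esub> B ! i) < enat r"
      obtain u where u: "u \<in> carrier G" "h u = h g \<otimes>\<^bsub>H\<^esub> B ! i"
        using h hc[of g] Bc[of i] gi unfolding bij_betw_def by (metis H.m_closed imageE)
      then have ud: "?dG u < enat r" using d distl[OF u(1)] unfolding u(2) by blast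
      then obtain k where "Suc k \<le> r" "u \<in> P k" using distP u by blast
      then have "u = g \<otimes>\<^bsub>G\<^esub> A ! i" using reflect[of u k g i] u gi by simp
      then show ?thesis using ud by simp
    qed (use distl gi in simp)
  qed
  let ?f = "\<lparr> iso_verts = h, iso_arcs = map_prod h id, iso_head = head \<Delta>', iso_tail = tail \<Delta>' \<rparr>"
  have verts: "verts \<Delta>' = h ` verts \<Delta>"
  proof -
    have "verts \<Delta>' = {v \<in> h ` carrier G. ?dH v \<le> enat r}"
      using h by (simp add: \<Delta>'_def graph_ball_def cayley_graph_def bij_betw_def)
    also have "\<dots> = h ` {g \<in> carrier G. ?dG g \<le> enat r}"
      using dist[of r] by auto
    finally show ?thesis by (simp add: \<Delta>_def graph_ball_def cayley_graph_def)
  qed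
  have arcs: "arcs \<Delta>' = map_prod h id ` arcs \<Delta>"
  proof -
    have "arcs \<Delta>' = {(v, i). v \<in> h ` carrier G \<and> i < length A \<and>
        (?dH v < enat r \<or> ?dH (v \<otimes>\<^bsub>H\<^esub> B ! i) < enat r)}"
      using h len by (auto simp: \<Delta>'_def graph_ball_def cayley_graph_def bij_betw_def)
    also have "\<dots> = map_prod h id ` {(g, i). g \<in> carrier G \<and> i < length A \<and>
        (?dG g < enat r \<or> ?dG (g \<otimes>\<^bsub>G\<^esub> A ! i) < enat r)}"
      using arc by (force simp: image_iff)
    also have "{(g, i). g \<in> carrier G \<and> i < length A \<and>
        (?dG g < enat r \<or> ?dG (g \<otimes>\<^bsub>G\<^esub> A ! i) < enat r)} = arcs \<Delta>"
      by (auto simp: \<Delta>_def graph_ball_def cayley_graph_def)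
    finally show ?thesis .
  qed
  have wf: "wf_digraph \<Delta>"
    unfolding \<Delta>_def by (intro wf_graph_ball wf_cayley_graph G.is_group A)
  have "inj_on h (verts \<Delta>)"
    using hinj by (auto simp: \<Delta>_def graph_ball_def cayley_graph_def inj_on_def)
  moreover have "inj_on (map_prod h id) (arcs \<Delta>)"
    using hinj by (auto simp: \<Delta>_def graph_ball_def cayley_graph_def inj_on_def)
  moreover have "h (tail \<Delta> e) = tail \<Delta>' (map_prod h id e) \<and> h (head \<Delta> e) = head \<Delta>' (map_prod h id e)"
    if "e \<in> arcs \<Delta>" for e
    using that hedge by (auto simp: \<Delta>_def \<Delta>'_def graph_ball_def cayley_graph_def)
  ultimately have "pre_digraph.digraph_isomorphism \<Delta> ?f"
    using wf by (simp add: pre_digraph.digraph_isomorphism_def)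
  moreover have "\<Delta>' = app_iso ?f \<Delta>"
    using verts arcs by (intro pre_digraph.equality) (auto simp: app_iso_def)
  ultimately show ?thesis
    unfolding marked_sim_def Let_def prod.case \<Delta>_def[symmetric] \<Delta>'_def[symmetric]
    by (intro exI[of _ ?f]) (simp add: h1)
qed

text \<open>An isomorphism respects the generators everywhere, so \<open>P\<close> may be the whole
  carrier at every radius.\<close>

lemma marked_iso_imp_marked_sim:
  assumes "(x, y) \<in> marked_iso"
  shows "marked_sim r x y"
proof -
  obtain G A H B where e: "x = (G, A)" "y = (H, B)" by (cases x, cases y)
  obtain h where h: "h \<in> iso G H" "map h A = B"
    and m: "x \<in> marked_groups" "y \<in> marked_groups"
    using assms by (auto simp: marked_iso_def e)
  have g: "group G" "group H" "set A \<subseteq> carrier G" "set B \<subseteq> carrier H"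
    using m by (auto simp: e marked_groups_def)
  show ?thesis
    unfolding e
  proof (rule marked_sim_local[where h = h and P = "\<lambda>_. carrier G"])
    show "bij_betw h (carrier G) (carrier H)" "h \<one>\<^bsub>G\<^esub> = \<one>\<^bsub>H\<^esub>"
      using h g by (auto simp: iso_def intro: hom_one)
    fix a i assume a: "a \<in> carrier G" "i < length A"
    then have "A ! i \<in> carrier G" using g nth_mem by blast
    then show "a \<otimes>\<^bsub>G\<^esub> A ! i \<in> carrier G" "h (a \<otimes>\<^bsub>G\<^esub> A ! i) = h a \<otimes>\<^bsub>H\<^esub> B ! i"
      using a h g by (auto simp: iso_def hom_def group.is_monoid monoid.m_closed)
  qed (use g h in \<open>auto simp: group.is_monoid monoid.one_closed\<close>)
qed

lemma marked_sim_trans: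
  assumes "marked_sim r x y" "marked_sim r y z"
  shows "marked_sim r x z"
proof -
  define \<Delta> where "\<Delta> = (\<lambda>x :: 'a monoid \<times> 'a list.
    graph_ball (cayley_graph (fst x) (snd x)) \<one>\<^bsub>fst x\<^esub> r)"
  have sim: "marked_sim r x y \<longleftrightarrow> (\<exists>f. pre_digraph.digraph_isomorphism (\<Delta> x) f \<and>
      \<Delta> y = app_iso f (\<Delta> x) \<and> iso_verts f \<one>\<^bsub>fst x\<^esub> = \<one>\<^bsub>fst y\<^esub> \<and>
      (\<forall>e \<in> arcs (\<Delta> x). snd (iso_arcs f e) = snd e))" for x y
    unfolding marked_sim_def \<Delta>_def Let_def by (simp add: case_prod_beta)
  obtain f g where f: "pre_digraph.digraph_isomorphism (\<Delta> x) f" "\<Delta> y = app_iso f (\<Delta> x)"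
      "iso_verts f \<one>\<^bsub>fst x\<^esub> = \<one>\<^bsub>fst y\<^esub>" "\<forall>e \<in> arcs (\<Delta> x). snd (iso_arcs f e) = snd e"
    and g: "pre_digraph.digraph_isomorphism (\<Delta> y) g" "\<Delta> z = app_iso g (\<Delta> y)"
      "iso_verts g \<one>\<^bsub>fst y\<^esub> = \<one>\<^bsub>fst z\<^esub>" "\<forall>e \<in> arcs (\<Delta> y). snd (iso_arcs g e) = snd e"
    using assms unfolding sim by blast
  let ?k = "\<lparr> iso_verts = iso_verts g \<circ> iso_verts f, iso_arcs = iso_arcs g \<circ> iso_arcs f,
    iso_head = iso_head g, iso_tail = iso_tail g \<rparr>"
  have "pre_digraph.digraph_isomorphism (\<Delta> x) ?k"
    using f(1,2) g(1) by (auto simp: pre_digraph.digraph_isomorphism_def intro!: comp_inj_on)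
  moreover have "\<Delta> z = app_iso ?k (\<Delta> x)"
    unfolding g(2) f(2) by (simp add: app_iso_def image_comp)
  ultimately show ?thesis
    unfolding sim using f g by (intro exI[of _ ?k]) simp
qed

section \<open>Stable classes and limits in the union of the spaces\<close>

lemma marked_iso_imp_stable_iso: "(x, y) \<in> marked_iso \<Longrightarrow> (x, y) \<in> stable_iso"
  by (cases x; cases y) (auto simp: stable_iso_def marked_iso_def pad_def intro!: exI[of _ 0])

lemma stable_iso_class: "x \<in> marked_groups \<Longrightarrow> stable_iso `` (marked_iso `` {x}) = stable_iso `` {x}"
  using equiv_stable_iso equiv_marked_iso marked_iso_imp_stable_iso
  unfolding equiv_def trans_def refl_on_def by blast

text \<open>\<open>A\<close> and \<open>B\<close> are initial segments of equal length of the padded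
  tuples, so matching the padded tuples matches \<open>A\<close> with \<open>B\<close>.\<close>

lemma stable_iso_imp_marked_iso:
  assumes "((G, A), (H, B)) \<in> stable_iso" "length A = length B"
  shows "((G, A), (H, B)) \<in> marked_iso"
proof -
  obtain j k where "(pad j (G, A), pad k (H, B)) \<in> marked_iso"
    and m: "(G, A) \<in> marked_groups" "(H, B) \<in> marked_groups"
    using assms by (auto simp: stable_iso_def)
  then obtain h where "h \<in> iso G H"
    "map h A @ replicate j (h \<one>\<^bsub>G\<^esub>) = B @ replicate k \<one>\<^bsub>H\<^esub>"
    by (auto simp: marked_iso_def pad_def)
  then show ?thesis
    using m assms(2) by (auto simp: marked_iso_def append_eq_append_conv)
qed

text \<open>Openness in the union is tested on the space of \<open>n\<close>-generated marked
  groups. There a subbasic set of radius \<open>r\<close> that contains the limit contains all terms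
  from index \<open>r\<close> on, by transitivity of \<open>marked_sim r\<close>; induction on the
  generation of open sets does the rest.\<close>

lemma limitin_all_marked_topology:
  assumes x0: "x0 \<in> marked_groups" "length (snd x0) = n"
    and x: "\<And>m. x m \<in> marked_groups" "\<And>m. length (snd (x m)) = n"
    and sim: "\<And>r m. r \<le> m \<Longrightarrow> marked_sim r (x m) x0"
  shows "limitin all_marked_topology (\<lambda>m. stable_iso `` {x m}) (stable_iso `` {x0}) sequentially"
proof -
  define X where "X = (\<lambda>m. marked_iso `` {x m})"
  define X0 where "X0 = marked_iso `` {x0}"
  have sp: "X m \<in> marked_space n" "X0 \<in> marked_space n" for m
    using x0 x[of m] by (auto simp: X_def X0_def marked_space_def case_prod_beta intro!: quotientI)
  have ev: "\<exists>R. \<forall>m\<ge>R. X m \<in> V" if "openin (marked_topology n) V" "X0 \<in> V" for V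
  proof -
    have "generate_topology_on {marked_nbhd n r X | r X. X \<in> marked_space n} V"
      using that unfolding marked_topology_def by (simp add: openin_topology_generated_by_iff)
    then show ?thesis using that(2)
    proof (induction)
      case Empty
      then show ?case by simp
    next
      case (Int a b)
      then obtain R S where "\<forall>m\<ge>R. X m \<in> a" "\<forall>m\<ge>S. X m \<in> b" by auto
      then show ?case by (intro exI[of _ "max R S"]) auto
    next
      case (UN K)
      then show ?case by blast
    next
      case (Basis s)
      then obtain r Z where s: "s = marked_nbhd n r Z" by blast
      then obtain z y where z: "z \<in> Z" "y \<in> X0" "marked_sim r y z"
        using Basis unfolding marked_nbhd_def by blast
      then have "marked_sim r x0 y" using marked_iso_imp_marked_sim by (auto simp: X0_def)
      then have "marked_sim r (x m) z" if "r \<le> m" for m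
        using sim[OF that] z(3) marked_sim_trans by blast
      moreover have "x m \<in> X m" for m
        using x(1) equiv_class_self[OF equiv_marked_iso] by (auto simp: X_def)
      ultimately show ?case
        using z sp unfolding s marked_nbhd_def by blast
    qed
  qed
  have "eventually (\<lambda>m. stable_iso `` {x m} \<in> U) sequentially"
    if "openin all_marked_topology U" "stable_iso `` {x0} \<in> U" for U
  proof -
    have "openin (marked_topology n) {X \<in> marked_space n. stable_iso `` X \<in> U}"
      using that openin_all_marked_topology by blast
    moreover have "X0 \<in> {X \<in> marked_space n. stable_iso `` X \<in> U}"
      using that sp stable_iso_class[OF x0(1)] by (simp add: X0_def)
    ultimately obtain R where "\<forall>m\<ge>R. stable_iso `` X m \<in> U"
      using ev by blast
    then show ?thesis
      using x(1) by (auto simp: eventually_sequentially X_def stable_iso_class)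
  qed
  moreover have "stable_iso `` {x0} \<in> topspace all_marked_topology"
    using x0 by (simp add: topspace_all_marked_topology all_marked_space_def quotientI)
  ultimately show ?thesis by (simp add: limitin_def)
qed

text \<open>In a discrete subspace the limit is an isolated point, so the convergent sequence would
  have to reach it, against \<open>ne\<close>.\<close>

lemma condensedI:
  assumes y: "y \<in> marked_groups" "length (snd y) = n" "fst y \<cong> G"
    and x: "\<And>m. x m \<in> marked_groups" "\<And>m. length (snd (x m)) = n" "\<And>m. fst (x m) \<cong> G"
    and sim: "\<And>r m. r \<le> m \<Longrightarrow> marked_sim r (x m) y"
    and ne: "\<And>m. (x m, y) \<notin> stable_iso"
  shows "condensed G"
  unfolding condensed_def
proof
  assume d: "subtopology all_marked_topology (iso_class G) = discrete_topology (iso_class G)"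
  have cls: "stable_iso `` {z} \<in> iso_class G" if "z \<in> marked_groups" "fst z \<cong> G" for z
    using that equiv_class_self[OF equiv_stable_iso that(1)]
    by (cases z) (auto simp: iso_class_def all_marked_space_def intro!: quotientI)
  let ?p = "stable_iso `` {y}"
  have "limitin (subtopology all_marked_topology (iso_class G)) (\<lambda>m. stable_iso `` {x m}) ?p sequentially"
    using limitin_all_marked_topology[OF y(1,2) x(1,2) sim] cls y x
    by (simp add: limitin_subtopology)
  then have "eventually (\<lambda>m. stable_iso `` {x m} \<in> {?p}) sequentially"
    by (rule limitinD) (use d cls y in auto)
  then obtain m where "stable_iso `` {x m} = ?p"
    by (auto simp: eventually_sequentially)
  then show False
    using ne x(1) y(1) eq_equiv_class_iff[OF equiv_stable_iso] by blast
qed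

section \<open>The groups \<open>G\<^sub>\<phi>\<close>\<close>

text \<open>This provides \<open>to_nat\<close> on the groups below. A finitely supported function
  is determined by its graph over the support, and a countable set has only countably many finite
  subsets.\<close>

instance poly_mapping :: (countable, "{zero, countable}") countable
proof
  define g where "g = (\<lambda>p :: 'a \<Rightarrow>\<^sub>0 'b. (\<lambda>k. (k, Poly_Mapping.lookup p k)) ` Poly_Mapping.keys p)"
  have look: "Poly_Mapping.lookup p k = v \<longleftrightarrow> (k, v) \<in> g p \<or> v = 0 \<and> k \<notin> fst ` g p" for p k v
    by (auto simp: g_def image_iff in_keys_iff)
  have "inj g"
  proof (intro injI poly_mapping_eqI)
    fix p q k assume "g p = g q"
    then show "Poly_Mapping.lookup p k = Poly_Mapping.lookup q k"
      using look[of p] look[of q] by metis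
  qed
  moreover have "range g \<subseteq> {A. finite A}"
    by (auto simp: g_def)
  then have "countable (range g)"
    using countable_Collect_finite countable_subset by blast
  ultimately have "countable (UNIV :: ('a \<Rightarrow>\<^sub>0 'b) set)"
    by (rule countable_image_inj_on[rotated])
  then show "\<exists>f :: ('a \<Rightarrow>\<^sub>0 'b) \<Rightarrow> nat. inj f"
    by (auto simp: countable_def)
qed

text \<open>With convolution as product, \<open>frag_of i\<close> is the monomial \<open>t^i\<close>
  in the ring of Laurent polynomials.\<close>

lemma frag_of_mult: "frag_of i * frag_of j = (frag_of (i + j) :: int \<Rightarrow>\<^sub>0 int)"
  by (simp add: mult_single)

text \<open>For integer exponents this is the homomorphism from Laurent polynomials to integers
  along which the central subgroup is pushed out.\<close>

definition frag_sum :: "('a \<Rightarrow> int) \<Rightarrow> ('a \<Rightarrow>\<^sub>0 int) \<Rightarrow> int" where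
  "frag_sum \<phi> p = (\<Sum>i\<in>Poly_Mapping.keys p. Poly_Mapping.lookup p i * \<phi> i)"

lemma frag_sum_superset:
  "finite S \<Longrightarrow> Poly_Mapping.keys p \<subseteq> S \<Longrightarrow> frag_sum \<phi> p = (\<Sum>i\<in>S. Poly_Mapping.lookup p i * \<phi> i)"
  unfolding frag_sum_def by (rule sum.mono_neutral_left) (auto simp: in_keys_iff)

lemma frag_sum_add: "frag_sum \<phi> (p + q) = frag_sum \<phi> p + frag_sum \<phi> q"
proof -
  let ?S = "Poly_Mapping.keys p \<union> Poly_Mapping.keys q"
  have "Poly_Mapping.keys (p + q) \<subseteq> ?S" by (rule Poly_Mapping.keys_add)
  then show ?thesis
    by (simp add: frag_sum_superset[of ?S] lookup_add ring_distribs sum.distrib)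
qed

lemma frag_sum_zero [simp]: "frag_sum \<phi> 0 = 0"
  by (simp add: frag_sum_def)

lemma frag_sum_uminus: "frag_sum \<phi> (- p) = - frag_sum \<phi> p"
  using frag_sum_add[of \<phi> p "- p"] by simp

lemma frag_sum_diff: "frag_sum \<phi> (p - q) = frag_sum \<phi> p - frag_sum \<phi> q"
  using frag_sum_add[of \<phi> p "- q"] by (simp add: frag_sum_uminus)

lemma frag_sum_of [simp]: "frag_sum \<phi> (frag_of i) = \<phi> i"
  by (simp add: frag_sum_def)

lemma frag_sum_one [simp]: "frag_sum \<phi> 1 = \<phi> (0 :: int)"
  using frag_sum_of[of \<phi> 0] by (simp del: frag_sum_of)

text \<open>Both sides are additive and agree on monomials. This identity makes
  \<open>hall_shift\<close> a homomorphism.\<close>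

lemma frag_sum_shift: "frag_sum \<phi> (frag_of k * p) = frag_sum (\<lambda>i. \<phi> (k + i :: int)) p"
proof -
  have "Poly_Mapping.keys p \<subseteq> UNIV" by simp
  then show ?thesis
    by (induction p rule: frag_induction)
      (simp_all add: frag_of_mult right_diff_distrib frag_sum_diff)
qed

lemma frag_sum_cong:
  "(\<And>i. i \<in> Poly_Mapping.keys p \<Longrightarrow> \<phi> i = \<psi> i) \<Longrightarrow> frag_sum \<phi> p = frag_sum \<psi> p"
  by (simp add: frag_sum_def)

text \<open>The element \<open>(n, a, b, c)\<close> stands for the upper unitriangular matrix with entries \<open>a, b, c\<close>
  (\<open>c\<close> in the corner) times \<open>t\<^sup>n\<close>, where \<open>a\<close> and \<open>b\<close> are Laurent polynomials in \<open>t\<close>, the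
  polynomial in the corner is replaced by its image under the functional \<open>t\<^sup>i \<mapsto> \<phi> i\<close>, and
  conjugation by \<open>t\<close> maps \<open>a, b\<close> to \<open>t a, t\<^sup>-\<^sup>1 b\<close>.\<close>

type_synonym hall = "int \<times> (int \<Rightarrow>\<^sub>0 int) \<times> (int \<Rightarrow>\<^sub>0 int) \<times> int"

fun hall_mult :: "(int \<Rightarrow> int) \<Rightarrow> hall \<Rightarrow> hall \<Rightarrow> hall" where
  "hall_mult \<phi> (n, a, b, c) (n', a', b', c') =
     (n + n', a + frag_of n * a', b + frag_of (- n) * b', c + c' + frag_sum \<phi> (a * (frag_of (- n) * b')))"

definition hall_group :: "(int \<Rightarrow> int) \<Rightarrow> hall monoid" where
  "hall_group \<phi> = \<lparr>carrier = UNIV, monoid.mult = hall_mult \<phi>, one = (0, 0, 0, 0)\<rparr>"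

fun hall_inv :: "(int \<Rightarrow> int) \<Rightarrow> hall \<Rightarrow> hall" where
  "hall_inv \<phi> (n, a, b, c) = (- n, - frag_of (- n) * a, - frag_of n * b, frag_sum \<phi> (a * b) - c)"

definition hall_gens :: "hall list" where
  "hall_gens = [(1, 0, 0, 0), (0, 1, 0, 0), (0, 0, 1, 0)]"

lemma hall_group_simps [simp]:
  "carrier (hall_group \<phi>) = UNIV" "monoid.mult (hall_group \<phi>) = hall_mult \<phi>"
  "one (hall_group \<phi>) = (0, 0, 0, 0)"
  by (auto simp: hall_group_def)

lemma frag_of_mult_left: "frag_of i * (frag_of j * p) = frag_of (i + j) * (p :: int \<Rightarrow>\<^sub>0 int)"
  by (simp add: mult.assoc[symmetric] frag_of_mult)

lemma frag_of_mult_swap: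
  "frag_of i * p * (frag_of j * q) = frag_of (i + j) * (p * q :: int \<Rightarrow>\<^sub>0 int)"
  by (simp add: frag_of_mult[symmetric] ac_simps)

lemma hall_mult_assoc: "hall_mult \<phi> (hall_mult \<phi> x y) z = hall_mult \<phi> x (hall_mult \<phi> y z)"
proof -
  obtain n a b c n' a' b' c' n'' a'' b'' c''
    where "x = (n, a, b, c)" "y = (n', a', b', c')" "z = (n'', a'', b'', c'')"
    by (metis prod_cases4)
  \<comment> \<open>\<open>t\<close> multiplies the two off-diagonal entries by inverse powers and
    so fixes their product; hence \<open>t\<close> acts trivially on the corner.\<close>
  moreover have e: "frag_of n * a' * (frag_of (- n - n') * b'') = a' * (frag_of (- n') * b'')"
    by (simp add: frag_of_mult_swap mult.left_commute)
  ultimately show ?thesis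
    by (simp add: distrib_left distrib_right frag_sum_add frag_of_mult_left e)
qed

lemma hall_inv_left: "hall_mult \<phi> (hall_inv \<phi> x) x = (0, 0, 0, 0)"
  by (cases x) (simp add: frag_of_mult_swap frag_sum_uminus)

lemma hall_mult_one: "hall_mult \<phi> (0, 0, 0, 0) x = x"
  by (cases x) simp

interpretation hall: group "hall_group \<phi>" for \<phi>
proof (rule groupI)
  fix x assume "x \<in> carrier (hall_group \<phi>)"
  show "\<exists>y\<in>carrier (hall_group \<phi>). y \<otimes>\<^bsub>hall_group \<phi>\<^esub> x = \<one>\<^bsub>hall_group \<phi>\<^esub>"
    by (intro bexI[of _ "hall_inv \<phi> x"]) (simp_all add: hall_inv_left)
qed (simp_all add: hall_mult_assoc hall_mult_one)

lemma hall_inv [simp]: "inv\<^bsub>hall_group \<phi>\<^esub> x = hall_inv \<phi> x"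
  by (rule hall.inv_equality) (simp_all add: hall_inv_left)

text \<open>These words and those of \<open>hall_comm\<close> express monomials and corner elements
  in the generators; generation and rigidity of the marking both rest on them.\<close>

lemma hall_conj:
  "hall_mult \<phi> (hall_mult \<phi> (i, 0, 0, 0) (0, 1, 0, 0)) (- i, 0, 0, 0) = (0, frag_of i, 0, 0)"
  "hall_mult \<phi> (hall_mult \<phi> (- i, 0, 0, 0) (0, 0, 1, 0)) (i, 0, 0, 0) = (0, 0, frag_of i, 0)"
  by simp_all

lemma hall_comm:
  "hall_mult \<phi> (hall_mult \<phi> (0, a, 0, 0) (0, 0, b, 0))
     (hall_inv \<phi> (hall_mult \<phi> (0, 0, b, 0) (0, a, 0, 0))) = (0, 0, 0, frag_sum \<phi> (a * b))"
  by (simp add: frag_sum_uminus)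

section \<open>Generation by the three marked elements\<close>

lemma subgroup_int_powers:
  fixes G (structure)
  assumes "group G" "subgroup K G" and f: "\<And>m n :: int. f (m + n) = f m \<otimes> f n" "\<And>n. f n \<in> carrier G"
    and "f 1 \<in> K"
  shows "f n \<in> K"
proof -
  interpret group G by fact
  interpret subgroup K G by fact
  have "f 0 \<otimes> f 0 = f 0" using f(1)[of 0 0] by simp
  then have f0: "f 0 = \<one>" using f(2) by (metis r_cancel_one')
  have inv: "f (- 1) = inv (f 1)"
    using f(1)[of "- 1" 1] f0 f(2) by (simp add: inv_equality)
  show ?thesis
  proof (induction n rule: int_induct[of _ 0])
    case (step1 i)
    then show ?case using f(1)[of i 1] \<open>f 1 \<in> K\<close> by simp
  next
    case (step2 i)
    then show ?case using f(1)[of i "- 1"] \<open>f 1 \<in> K\<close> inv by simp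
  qed (simp add: f0)
qed

text \<open>Conjugates of \<open>x\<close> and \<open>y\<close> by powers of \<open>t\<close> give
  all monomials, and these give all \<open>a\<close> and \<open>b\<close>. The hypothesis turns the
  commutator of \<open>t^i x t^-i\<close> and \<open>y\<close> into
  \<open>(0, 0, 0, 1)\<close>.\<close>

lemma hall_generate:
  assumes "\<phi> i = 1"
  shows "generate (hall_group \<phi>) (set hall_gens) = UNIV"
proof -
  define K where "K = generate (hall_group \<phi>) (set hall_gens)"
  have K: "subgroup K (hall_group \<phi>)"
    unfolding K_def by (rule hall.generate_is_subgroup) simp
  have mult: "hall_mult \<phi> x y \<in> K" if "x \<in> K" "y \<in> K" for x y
    using subgroup.m_closed[OF K that] by simp
  have invs: "hall_inv \<phi> x \<in> K" if "x \<in> K" for x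
    using subgroup.m_inv_closed[OF K that] by simp
  have zero: "(0, 0, 0, 0) \<in> K"
    using subgroup.one_closed[OF K] by simp
  have gens: "(1, 0, 0, 0) \<in> K" "(0, 1, 0, 0) \<in> K" "(0, 0, 1, 0) \<in> K"
    unfolding K_def hall_gens_def by (auto intro: generate.incl)
  have n: "(n, 0, 0, 0) \<in> K" for n
    by (rule subgroup_int_powers[OF hall.is_group K, where f = "\<lambda>n. (n, 0, 0, 0)"])
      (use gens in auto)
  have ab1: "(0, frag_of i, 0, 0) \<in> K" "(0, 0, frag_of i, 0) \<in> K" for i
    using mult[OF mult[OF n[of i] gens(2)] n[of "- i"]]
      mult[OF mult[OF n[of "- i"] gens(3)] n[of i]] by (simp_all add: hall_conj del: hall_mult.simps)
  have a: "(0, a, 0, 0) \<in> K" for a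
  proof -
    have "Poly_Mapping.keys a \<subseteq> UNIV" by simp
    then show ?thesis
    proof (induction a rule: frag_induction)
      case (diff a b)
      then show ?case using mult[OF _ invs, of "(0, a, 0, 0)" "(0, b, 0, 0)"] by simp
    qed (use zero ab1 in auto)
  qed
  have b: "(0, 0, b, 0) \<in> K" for b
  proof -
    have "Poly_Mapping.keys b \<subseteq> UNIV" by simp
    then show ?thesis
    proof (induction b rule: frag_induction)
      case (diff a b)
      then show ?case using mult[OF _ invs, of "(0, 0, a, 0)" "(0, 0, b, 0)"] by simp
    qed (use zero ab1 in auto)
  qed
  have "(0, 0, 0, 1) \<in> K"
    using mult[OF mult[OF a[of "frag_of i"] b[of 1]] invs[OF mult[OF b[of 1] a[of "frag_of i"]]]] assms
    unfolding hall_comm by simp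
  then have c: "(0, 0, 0, c) \<in> K" for c
    by (rule subgroup_int_powers[OF hall.is_group K, where f = "\<lambda>c. (0, 0, 0, c)", rotated 2]) auto
  \<comment> \<open>The corner is corrected by what the product of \<open>(0, a, 0, 0)\<close> and
    \<open>(0, 0, b, 0)\<close> contributes.\<close>
  have "(n, a, b, c) \<in> K" for n a b c
    using mult[OF mult[OF mult[OF a[of a] b[of b]] c[of "c - frag_sum \<phi> (a * b)"]] n[of n]]
    by simp
  then show ?thesis
    unfolding K_def by auto
qed

section \<open>The derived series\<close>

lemma derived_subsetI:
  assumes "group G" "subgroup K G"
    and "\<And>x y. x \<in> H \<Longrightarrow> y \<in> H \<Longrightarrow> x \<otimes>\<^bsub>G\<^esub> y \<otimes>\<^bsub>G\<^esub> inv\<^bsub>G\<^esub> x \<otimes>\<^bsub>G\<^esub> inv\<^bsub>G\<^esub> y \<in> K"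
  shows "derived G H \<subseteq> K"
  unfolding derived_def using assms by (intro group.generate_subgroup_incl) auto

lemma derivedI:
  "x \<in> H \<Longrightarrow> y \<in> H \<Longrightarrow> x \<otimes>\<^bsub>G\<^esub> y \<otimes>\<^bsub>G\<^esub> inv\<^bsub>G\<^esub> x \<otimes>\<^bsub>G\<^esub> inv\<^bsub>G\<^esub> y \<in> derived G H"
  unfolding derived_def by (rule generate.incl) auto

text \<open>\<open>?H1\<close>, \<open>?H2\<close> and the trivial subgroup form a chain with
  abelian factors, recorded by \<open>n\<close>, by \<open>(a, b)\<close> and by
  \<open>c\<close>.\<close>

lemma hall_derived3: "(derived (hall_group \<phi>) ^^ 3) UNIV = {(0, 0, 0, 0)}"
proof -
  let ?D = "derived (hall_group \<phi>)"
  let ?H1 = "{(n, a, b, c). n = 0} :: hall set"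
  let ?H2 = "{(n, a, b, c). n = 0 \<and> a = 0 \<and> b = 0} :: hall set"
  have 1: "?D UNIV \<subseteq> ?H1"
    by (rule derived_subsetI) (auto intro!: hall.subgroupI)
  have 2: "?D ?H1 \<subseteq> ?H2"
    by (rule derived_subsetI) (auto intro!: hall.subgroupI)
  have 3: "?D ?H2 \<subseteq> {(0, 0, 0, 0)}"
    by (rule derived_subsetI) (auto intro!: hall.subgroupI)
  have "?D (?D (?D UNIV)) \<subseteq> ?D (?D ?H1)"
    by (intro hall.mono_derived 1)
  also have "\<dots> \<subseteq> ?D ?H2"
    by (intro hall.mono_derived 2)
  also note 3
  finally have "(?D ^^ 3) UNIV \<subseteq> {(0, 0, 0, 0)}"
    by (simp add: numeral_3_eq_3)
  moreover have "(0, 0, 0, 0) \<in> (?D ^^ 3) UNIV"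
  proof -
    have "subgroup ((?D ^^ 3) (carrier (hall_group \<phi>))) (hall_group \<phi>)"
      by (rule hall.exp_of_derived_is_subgroup[OF hall.subgroup_self])
    from subgroup.one_closed[OF this] show ?thesis by simp
  qed
  ultimately show ?thesis by blast
qed

text \<open>The element is the commutator of \<open>[t, x]\<close> and \<open>[t, y]\<close>, whose
  off-diagonal entries are \<open>t - 1\<close> and \<open>t^-1 - 1\<close>; the corner is the image
  of their product \<open>2 - t - t^-1\<close>.\<close>

lemma hall_derived2:
  "(0, 0, 0, 2 * \<phi> 0 - \<phi> 1 - \<phi> (- 1)) \<in> (derived (hall_group \<phi>) ^^ 2) UNIV"
proof -
  let ?D = "derived (hall_group \<phi>)"
  have a: "(0, frag_of 1 - 1, 0, 0) \<in> ?D UNIV"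
    using derivedI[of "(1, 0, 0, 0)" UNIV "(0, 1, 0, 0)" "hall_group \<phi>"] by simp
  have b: "(0, 0, frag_of (- 1) - 1, 0) \<in> ?D UNIV"
    using derivedI[of "(1, 0, 0, 0)" UNIV "(0, 0, 1, 0)" "hall_group \<phi>"] by simp
  have p: "(frag_of 1 - 1) * (frag_of (- 1) - 1) = (1 - frag_of 1 - frag_of (- 1) + 1 :: int \<Rightarrow>\<^sub>0 int)"
    by (simp add: algebra_simps frag_of_mult)
  have "frag_sum \<phi> ((frag_of 1 - 1) * (frag_of (- 1) - 1)) = 2 * \<phi> 0 - \<phi> 1 - \<phi> (- 1)"
    unfolding p frag_sum_add frag_sum_diff by simp
  then show ?thesis
    using derivedI[OF a b, of "hall_group \<phi>"] by (simp add: numeral_2_eq_2 frag_sum_uminus)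
qed

section \<open>Shifts of the defining function and rigidity of the marking\<close>

text \<open>Fixes \<open>t\<close> and \<open>y\<close> and sends \<open>x\<close> to
  \<open>t^k x t^-k\<close>.\<close>

definition hall_shift :: "int \<Rightarrow> hall \<Rightarrow> hall" where
  "hall_shift k = (\<lambda>(n, a, b, c). (n, frag_of k * a, b, c))"

lemma hall_shift_iso: "hall_shift k \<in> iso (hall_group (\<lambda>i. \<phi> (k + i))) (hall_group \<phi>)"
proof -
  have "hall_shift (- k) (hall_shift k x) = x" "hall_shift k (hall_shift (- k) x) = x" for x
    by (cases x; simp add: hall_shift_def frag_of_mult_left)+
  then have "bij (hall_shift k)"
    by (intro o_bij[of "hall_shift (- k)"]) auto
  moreover have "hall_shift k (hall_mult (\<lambda>i. \<phi> (k + i)) x y) =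
      hall_mult \<phi> (hall_shift k x) (hall_shift k y)" for x y
    by (cases x; cases y) (simp add: hall_shift_def distrib_left mult.assoc frag_sum_shift frag_of_mult_left add.commute)
  ultimately show ?thesis
    by (auto simp: iso_def hom_def)
qed

text \<open>The commutator of \<open>t^i x t^-i\<close> and \<open>y\<close> is one word in the
  generators; its values in the two groups are the two elements compared here.\<close>

lemma hall_hom_fixing_gens:
  assumes h: "h \<in> hom (hall_group \<psi>) (hall_group \<phi>)" and gens: "map h hall_gens = hall_gens"
  shows "h (0, 0, 0, \<psi> i) = (0, 0, 0, \<phi> i)"
proof -
  have mult: "h (hall_mult \<psi> x y) = hall_mult \<phi> (h x) (h y)" for x y
    using hom_mult[OF h, of x y] by simp
  interpret h: group_hom "hall_group \<psi>" "hall_group \<phi>" h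
    using h by unfold_locales auto
  have invs: "h (hall_inv \<psi> x) = hall_inv \<phi> (h x)" for x
    using h.hom_inv[of x] by simp
  have g: "h (1, 0, 0, 0) = (1, 0, 0, 0)" "h (0, 1, 0, 0) = (0, 1, 0, 0)" "h (0, 0, 1, 0) = (0, 0, 1, 0)"
    using gens by (auto simp: hall_gens_def)
  have n: "h (n, 0, 0, 0) = (n, 0, 0, 0)" for n
  proof (induction n rule: int_induct[of _ 0])
    case base
    then show ?case using h.hom_one by simp
  next
    case (step1 i)
    then show ?case using mult[of "(i, 0, 0, 0)" "(1, 0, 0, 0)"] g by simp
  next
    case (step2 i)
    then show ?case using mult[of "(i, 0, 0, 0)" "hall_inv \<psi> (1, 0, 0, 0)"] invs[of "(1, 0, 0, 0)"] g by simp
  qed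
  have "h (hall_mult \<psi> (hall_mult \<psi> (i, 0, 0, 0) (0, 1, 0, 0)) (- i, 0, 0, 0)) = (0, frag_of i, 0, 0)"
    unfolding mult n g by simp
  then have a: "h (0, frag_of i, 0, 0) = (0, frag_of i, 0, 0)"
    by (simp only: hall_conj)
  have "h (hall_mult \<psi> (hall_mult \<psi> (0, frag_of i, 0, 0) (0, 0, 1, 0))
      (hall_inv \<psi> (hall_mult \<psi> (0, 0, 1, 0) (0, frag_of i, 0, 0)))) = (0, 0, 0, frag_sum \<phi> (frag_of i * 1))"
    unfolding mult invs a g by (rule hall_comm)
  then show ?thesis
    by (simp only: hall_comm mult_1_right frag_sum_of)
qed

section \<open>Balls depend on finitely many values of the defining function\<close>

text \<open>No condition on the last two entries: \<open>\<phi>\<close> enters a product with a generator only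
  through \<open>n\<close> and \<open>a\<close>.\<close>

fun hall_ball :: "nat \<Rightarrow> hall \<Rightarrow> bool" where
  "hall_ball k (n, a, b, c) \<longleftrightarrow> \<bar>n\<bar> \<le> int k \<and> Poly_Mapping.keys a \<subseteq> {- int k..int k}"

lemma hall_ball_Suc: "hall_ball k x \<Longrightarrow> hall_ball (Suc k) x"
  by (cases x) auto

text \<open>Right multiplication by \<open>t\<close> raises \<open>n\<close> by one, by
  \<open>x\<close> adds the monomial \<open>t^n\<close> to \<open>a\<close>, and by \<open>y\<close>
  changes neither \<open>n\<close> nor \<open>a\<close>.\<close>

lemma hall_ball_mult:
  assumes "hall_ball k x" "i < length hall_gens"
  shows "hall_ball (Suc k) (hall_mult \<phi> x (hall_gens ! i))"
proof -
  obtain n a b c where x: "x = (n, a, b, c)" by (cases x)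
  have n: "\<bar>n\<bar> \<le> int k" and a: "Poly_Mapping.keys a \<subseteq> {- int (Suc k)..int (Suc k)}"
    using hall_ball_Suc[OF assms(1)] assms(1) by (simp_all add: x)
  have "Poly_Mapping.keys (a + frag_of n) \<subseteq> Poly_Mapping.keys a \<union> {n}"
    using Poly_Mapping.keys_add[of a "frag_of n"] by simp
  also have "\<dots> \<subseteq> {- int (Suc k)..int (Suc k)}"
    using a n by auto
  finally have an: "Poly_Mapping.keys (a + frag_of n) \<subseteq> {- int (Suc k)..int (Suc k)}" .
  have "i = 0 \<or> i = 1 \<or> i = 2" using assms(2) by (auto simp: hall_gens_def)
  then show ?thesis
    using n a an by (elim disjE) (simp_all add: x hall_gens_def)
qed

lemma hall_ball_mult_rev:
  assumes "hall_ball k (hall_mult \<phi> x (hall_gens ! i))" "i < length hall_gens"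
  shows "hall_ball (Suc k) x"
proof -
  obtain n a b c where x: "x = (n, a, b, c)" by (cases x)
  have "i = 0 \<or> i = 1 \<or> i = 2" using assms(2) by (auto simp: hall_gens_def)
  then show ?thesis
  proof (elim disjE)
    assume i: "i = 1"
    have "Poly_Mapping.keys a \<subseteq> Poly_Mapping.keys (a + frag_of n) \<union> {n}"
      using keys_diff[of "a + frag_of n" "frag_of n"] by simp
    also have "\<dots> \<subseteq> {- int (Suc k)..int (Suc k)}"
      using hall_ball_Suc[OF assms(1)] assms(1) by (auto simp: x hall_gens_def i)
    finally show ?thesis
      using assms(1) by (simp add: x hall_gens_def i)
  qed (use hall_ball_Suc[OF assms(1)] assms(1) in \<open>auto simp: x hall_gens_def\<close>)
qed

text \<open>Only the product with \<open>y\<close> involves \<open>\<phi>\<close>, through the image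
  of \<open>a t^-n\<close>. Its exponents are differences \<open>l - n\<close> of numbers of
  absolute value at most \<open>r\<close>, whence the bound \<open>2 * r\<close>.\<close>

lemma hall_mult_gens_cong:
  assumes "hall_ball r x" "i < length hall_gens" "\<And>j. \<bar>j\<bar> \<le> 2 * int r \<Longrightarrow> \<phi> j = \<psi> j"
  shows "hall_mult \<phi> x (hall_gens ! i) = hall_mult \<psi> x (hall_gens ! i)"
proof -
  obtain n a b c where x: "x = (n, a, b, c)" by (cases x)
  have "i = 0 \<or> i = 1 \<or> i = 2" using assms(2) by (auto simp: hall_gens_def)
  moreover have "frag_sum \<phi> (a * frag_of (- n)) = frag_sum \<psi> (a * frag_of (- n))"
  proof (rule frag_sum_cong)
    fix j assume "j \<in> Poly_Mapping.keys (a * frag_of (- n))"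
    then obtain l where l: "l \<in> Poly_Mapping.keys a" "j = l - n"
      using keys_mult[of a "frag_of (- n)"] by auto
    have "\<bar>n\<bar> \<le> int r" "l \<in> {- int r..int r}"
      using assms(1) l(1) by (auto simp: x)
    then show "\<phi> j = \<psi> j"
      using l(2) by (intro assms(3)) auto
  qed
  ultimately show ?thesis
    unfolding x by (auto simp: hall_gens_def)
qed

section \<open>Transport to groups of natural numbers\<close>

lemma image_group_iso: "inj_on f (carrier G) \<Longrightarrow> f \<in> iso G (image_group f G)"
  by (auto simp: iso_def hom_def image_group_def bij_betw_def)

lemma image_group_group: "group G \<Longrightarrow> inj_on f (carrier G) \<Longrightarrow> group (image_group f G)"
  using group.iso_imp_img_group[OF _ image_group_iso, of G f] by (simp add: image_group_def)

text \<open>Both groups have the same underlying set, and the identity map respects the generators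
  on the image of \<open>hall_ball r\<close>.\<close>

lemma marked_sim_hall:
  fixes f :: "hall \<Rightarrow> 'a"
  assumes f: "inj f" and eq: "\<And>j. \<bar>j\<bar> \<le> 2 * int r \<Longrightarrow> \<psi> j = \<phi> j"
  shows "marked_sim r (image_group f (hall_group \<psi>), map f hall_gens)
    (image_group f (hall_group \<phi>), map f hall_gens)"
proof (rule marked_sim_local[where h = id and P = "\<lambda>k. f ` {x. hall_ball k x}"])
  let ?G = "image_group f (hall_group \<psi>)"
  have mult: "f x \<otimes>\<^bsub>image_group f (hall_group \<chi>)\<^esub> f y = f (hall_mult \<chi> x y)" for \<chi> x y
    using f by (simp add: image_group_def)
  show "group (image_group f (hall_group \<psi>))" "group (image_group f (hall_group \<phi>))"
    using f by (simp_all add: image_group_group hall.is_group)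
  show "\<one>\<^bsub>?G\<^esub> \<in> f ` {x. hall_ball 0 x}"
    by (simp add: image_group_def)
  fix k show "f ` {x. hall_ball k x} \<subseteq> f ` {x. hall_ball (Suc k) x}"
    using hall_ball_Suc by blast
  fix g i assume "g \<in> carrier ?G" and i: "i < length (map f hall_gens)"
  then obtain x where x: "g = f x"
    by (auto simp: image_group_def)
  have g: "g \<otimes>\<^bsub>image_group f (hall_group \<chi>)\<^esub> map f hall_gens ! i = f (hall_mult \<chi> x (hall_gens ! i))" for \<chi>
    using i by (simp add: x mult)
  have mem: "f y \<in> f ` {x. hall_ball k x} \<longleftrightarrow> hall_ball k y" for y k
    using f by (simp add: inj_image_mem_iff)
  show "g \<in> f ` {x. hall_ball k x} \<Longrightarrow> g \<otimes>\<^bsub>?G\<^esub> map f hall_gens ! i \<in> f ` {x. hall_ball (Suc k) x}"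
    unfolding g mem using i by (simp add: x mem hall_ball_mult)
  show "g \<otimes>\<^bsub>?G\<^esub> map f hall_gens ! i \<in> f ` {x. hall_ball k x} \<Longrightarrow> g \<in> f ` {x. hall_ball (Suc k) x}"
    unfolding g mem using i by (auto simp: x mem intro: hall_ball_mult_rev)
  show "g \<in> f ` {x. hall_ball r x} \<Longrightarrow>
      id (g \<otimes>\<^bsub>?G\<^esub> map f hall_gens ! i) = id g \<otimes>\<^bsub>image_group f (hall_group \<phi>)\<^esub> map f hall_gens ! i"
    unfolding id_apply g using i by (simp add: x mem hall_mult_gens_cong[OF _ _ eq])
qed (auto simp: image_group_def)

abbreviation nat_hall :: "(int \<Rightarrow> int) \<Rightarrow> nat monoid" where
  "nat_hall \<phi> \<equiv> image_group to_nat (hall_group \<phi>)"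

abbreviation nat_hall_gens :: "nat list" where
  "nat_hall_gens \<equiv> map to_nat hall_gens"

lemma nat_hall_iso: "to_nat \<in> iso (hall_group \<phi>) (nat_hall \<phi>)"
  by (rule image_group_iso) simp

lemma nat_hall_group: "group (nat_hall \<phi>)"
  by (simp add: image_group_group hall.is_group)

lemma nat_hall_group_hom: "group_hom (hall_group \<phi>) (nat_hall \<phi>) to_nat"
  using nat_hall_iso nat_hall_group hall.is_group
  by (auto simp: group_hom_def group_hom_axioms_def iso_def)

lemma nat_hall_generate:
  assumes "\<phi> i = 1"
  shows "generate (nat_hall \<phi>) (set nat_hall_gens) = carrier (nat_hall \<phi>)"
  using group_hom.generate_img[OF nat_hall_group_hom[of \<phi>], of "set hall_gens"]
  by (simp add: hall_generate[of \<phi> i, OF assms] image_group_def)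

lemma nat_hall_marked: "\<phi> i = 1 \<Longrightarrow> (nat_hall \<phi>, nat_hall_gens) \<in> marked_groups"
  using nat_hall_generate[of \<phi> i] by (auto simp: marked_groups_def nat_hall_group image_group_carrier)

lemma nat_hall_shift: "nat_hall (\<lambda>i. \<phi> (k + i)) \<cong> nat_hall \<phi>"
proof -
  have "nat_hall (\<lambda>i. \<phi> (k + i)) \<cong> hall_group (\<lambda>i. \<phi> (k + i))"
    by (rule group.iso_sym[OF hall.is_group is_isoI[OF nat_hall_iso]])
  also have "\<dots> \<cong> hall_group \<phi>"
    by (rule is_isoI[OF hall_shift_iso])
  also have "\<dots> \<cong> nat_hall \<phi>"
    by (rule is_isoI[OF nat_hall_iso])
  finally show ?thesis .
qed

text \<open>The tuples have equal length, so the isomorphism matches the generators and sends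
  \<open>(0, 0, 0, \<psi> i)\<close> to \<open>(0, 0, 0, \<phi> i)\<close>; by injectivity one is
  the identity exactly when the other is.\<close>

lemma nat_hall_stable_iso:
  assumes "((nat_hall \<psi>, nat_hall_gens), (nat_hall \<phi>, nat_hall_gens)) \<in> stable_iso"
  shows "\<psi> i = 0 \<longleftrightarrow> \<phi> i = 0"
proof -
  obtain h where h: "h \<in> iso (nat_hall \<psi>) (nat_hall \<phi>)" "map h nat_hall_gens = nat_hall_gens"
    using stable_iso_imp_marked_iso[OF assms] by (auto simp: marked_iso_def)
  define h' :: "hall \<Rightarrow> hall" where "h' = inv_into (carrier (hall_group \<phi>)) to_nat \<circ> (h \<circ> to_nat)"
  have iso: "h' \<in> iso (hall_group \<psi>) (hall_group \<phi>)"
    unfolding h'_def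
    by (intro iso_set_trans[OF iso_set_trans[OF nat_hall_iso h(1)]]
        group.iso_set_sym[OF hall.is_group nat_hall_iso])
  have "map h' hall_gens = hall_gens"
    using h(2) by (auto simp: h'_def hall_gens_def)
  then have "h' (0, 0, 0, \<psi> i) = (0, 0, 0, \<phi> i)"
    using hall_hom_fixing_gens[of h'] iso by (simp add: iso_def)
  moreover have "h' (0, 0, 0, 0) = (0, 0, 0, 0)"
    using hom_one[of h' "hall_group \<psi>" "hall_group \<phi>"] iso hall.is_group by (simp add: iso_def)
  moreover have "inj h'"
    using iso by (simp add: iso_def bij_betw_def)
  ultimately show ?thesis
    by (metis injD prod.inject)
qed

lemma nat_hall_derived:
  "(derived (nat_hall \<phi>) ^^ n) (carrier (nat_hall \<phi>)) = to_nat ` (derived (hall_group \<phi>) ^^ n) UNIV"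
  using group_hom.exp_of_derived_img[OF nat_hall_group_hom, of UNIV \<phi> n]
  by (simp add: image_group_def)

lemma nat_hall_derived3: "(derived (nat_hall \<phi>) ^^ 3) (carrier (nat_hall \<phi>)) = {\<one>\<^bsub>nat_hall \<phi>\<^esub>}"
  by (simp only: nat_hall_derived hall_derived3) (simp add: image_group_def)

lemma nat_hall_solvable: "solvable (nat_hall \<phi>)"
  using group.solvable_iff_trivial_derived_seq[OF nat_hall_group] nat_hall_derived3 by blast

text \<open>The hypothesis says that the second difference of \<open>\<phi>\<close> at
  \<open>0\<close> is nonzero, so \<open>hall_derived2\<close> exhibits a nontrivial element of the
  second derived subgroup.\<close>

lemma nat_hall_derived_length:
  assumes "\<phi> 1 + \<phi> (- 1) \<noteq> 2 * \<phi> 0"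
  shows "derived_length (nat_hall \<phi>) = 3"
  unfolding derived_length_def
proof (rule Least_equality)
  show "(derived (nat_hall \<phi>) ^^ 3) (carrier (nat_hall \<phi>)) = {\<one>\<^bsub>nat_hall \<phi>\<^esub>}"
    by (rule nat_hall_derived3)
  fix n assume n: "(derived (nat_hall \<phi>) ^^ n) (carrier (nat_hall \<phi>)) = {\<one>\<^bsub>nat_hall \<phi>\<^esub>}"
  show "3 \<le> n"
  proof (rule ccontr)
    assume "\<not> 3 \<le> n"
    then have "n \<le> 2" by simp
    interpret group "nat_hall \<phi>" by (rule nat_hall_group)
    \<comment> \<open>Once trivial, the derived series stays trivial, so \<open>n \<le> 2\<close>
      would make its second term trivial.\<close>
    have "derived (nat_hall \<phi>) {\<one>\<^bsub>nat_hall \<phi>\<^esub>} \<subseteq> {\<one>\<^bsub>nat_hall \<phi>\<^esub>}"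
      by (rule derived_incl[OF subset_refl triv_subgroup])
    then have "(derived (nat_hall \<phi>) ^^ m) {\<one>\<^bsub>nat_hall \<phi>\<^esub>} \<subseteq> {\<one>\<^bsub>nat_hall \<phi>\<^esub>}" for m
      by (induction m) (auto dest: mono_derived)
    then have "(derived (nat_hall \<phi>) ^^ (2 - n + n)) (carrier (nat_hall \<phi>)) \<subseteq> {\<one>\<^bsub>nat_hall \<phi>\<^esub>}"
      unfolding funpow_add o_apply n .
    then have "to_nat ` (derived (hall_group \<phi>) ^^ 2) UNIV \<subseteq> {to_nat ((0, 0, 0, 0) :: hall)}"
      using \<open>n \<le> 2\<close> by (simp add: nat_hall_derived) (simp add: image_group_def)
    then have "to_nat ((0, 0, 0, 2 * \<phi> 0 - \<phi> 1 - \<phi> (- 1)) :: hall) = to_nat ((0, 0, 0, 0) :: hall)"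
      using hall_derived2[of \<phi>] by blast
    then show False using assms by simp
  qed
qed

section \<open>A recurrent function without periods\<close>

text \<open>The condition says that \<open>i\<close> is nonzero with even 2-adic valuation.\<close>

definition toeplitz :: "int \<Rightarrow> int" where
  "toeplitz i = of_bool (\<exists>m. 2 * 4 ^ m dvd i - 4 ^ m)"

text \<open>The divisibility makes \<open>i\<close> an odd multiple of \<open>4 ^ m\<close>, hence
  at least \<open>4 ^ m\<close> in absolute value.\<close>

lemma pow4_not_dvd:
  assumes "\<bar>i\<bar> < 4 ^ m"
  shows "\<not> 2 * 4 ^ m dvd i - (4 ^ m :: int)"
proof
  assume "2 * 4 ^ m dvd i - (4 ^ m :: int)"
  then obtain q :: int where q: "i = 4 ^ m * (2 * q + 1)"
    by (auto simp: dvd_def algebra_simps)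
  have "1 \<le> \<bar>2 * q + 1\<bar>" by presburger
  then have "4 ^ m * 1 \<le> (4 ^ m * \<bar>2 * q + 1\<bar> :: int)"
    by (intro mult_left_mono) auto
  then show False using assms by (simp add: q abs_mult)
qed

text \<open>For \<open>m \<le> M\<close> the shift is a multiple of \<open>2 * 4 ^ m\<close> and
  does not affect the condition; for \<open>m > M\<close> both arguments are smaller than
  \<open>4 ^ m\<close> in absolute value, so the condition fails for both.\<close>

lemma toeplitz_shift:
  assumes "\<bar>i\<bar> < 2 * 4 ^ M"
  shows "toeplitz (2 * 4 ^ M + i) = toeplitz i"
proof -
  have "2 * 4 ^ m dvd 2 * 4 ^ M + i - 4 ^ m \<longleftrightarrow> 2 * 4 ^ m dvd i - (4 ^ m :: int)" for m
  proof (cases "m \<le> M")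
    case True
    then have "2 * 4 ^ m dvd (2 * 4 ^ M :: int)"
      by (intro mult_dvd_mono le_imp_power_dvd) auto
    then show ?thesis
      using dvd_add_right_iff[of "2 * 4 ^ m" "2 * 4 ^ M" "i - 4 ^ m"] by (simp add: algebra_simps)
  next
    case False
    then have "4 ^ Suc M \<le> (4 ^ m :: int)"
      by (intro power_increasing) auto
    then have "\<bar>i\<bar> < 4 ^ m" "\<bar>2 * 4 ^ M + i\<bar> < 4 ^ m"
      using assms by auto
    then show ?thesis by (simp add: pow4_not_dvd)
  qed
  then show ?thesis by (simp add: toeplitz_def)
qed

lemma toeplitz_one: "toeplitz 1 = 1" "toeplitz (- 1) = 1" "toeplitz (4 ^ m) = 1"
  by (auto simp: toeplitz_def intro: exI[of _ 0] exI[of _ m])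

lemma toeplitz_zero: "toeplitz 0 = 0"
  using pow4_not_dvd[of 0] by (auto simp: toeplitz_def)

lemma toeplitz_2pow: "toeplitz (2 * 4 ^ m) = 0"
  using toeplitz_shift[of 0 m] toeplitz_zero by simp

theorem corollary2p8:
  shows "\<exists>G :: nat monoid. group G \<and> finitely_generated G \<and> condensed G \<and>
           solvable G \<and> derived_length G = 3"
proof -
  \<comment> \<open>The shifts by \<open>2 * 4 ^ m\<close> converge pointwise to
    \<open>toeplitz\<close>, yet none of them equals it.\<close>
  define \<psi> where "\<psi> m i = toeplitz (2 * 4 ^ m + i)" for m i
  let ?G = "nat_hall toeplitz"
  have "condensed ?G"
  proof (rule condensedI[where y = "(?G, nat_hall_gens)" and x = "\<lambda>m. (nat_hall (\<psi> m), nat_hall_gens)"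
        and n = "length hall_gens"])
    show "(?G, nat_hall_gens) \<in> marked_groups"
      by (rule nat_hall_marked[of toeplitz, OF toeplitz_one(1)])
    show "fst (?G, nat_hall_gens) \<cong> ?G"
      using is_isoI[OF iso_set_refl] by simp
    fix m
    \<comment> \<open>This index is shifted to \<open>1\<close>, where \<open>toeplitz\<close> has
      the value \<open>1\<close> needed for generation.\<close>
    have "\<psi> m (1 - 2 * 4 ^ m) = 1"
      by (simp add: \<psi>_def toeplitz_one)
    then show "(nat_hall (\<psi> m), nat_hall_gens) \<in> marked_groups"
      by (rule nat_hall_marked[of "\<psi> m"])
    show "fst (nat_hall (\<psi> m), nat_hall_gens) \<cong> ?G"
      unfolding \<psi>_def fst_conv by (rule nat_hall_shift)
    \<comment> \<open>The shift doubles this argument to \<open>4 ^ Suc m\<close>, which changes the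
      parity of its 2-adic valuation.\<close>
    have "\<psi> m (2 * 4 ^ m) \<noteq> 0" "toeplitz (2 * 4 ^ m) = 0"
      using toeplitz_one(3)[of "Suc m"] by (simp_all add: \<psi>_def toeplitz_2pow)
    then show "((nat_hall (\<psi> m), nat_hall_gens), (?G, nat_hall_gens)) \<notin> stable_iso"
      using nat_hall_stable_iso by blast
    fix r assume "r \<le> m"
    \<comment> \<open>With this, \<open>2 * r \<le> 2 * m < 2 * 4 ^ m\<close>, the range in which
      \<open>toeplitz_shift\<close> applies.\<close>
    moreover have "int m < 4 ^ m"
      using of_nat_less_iff[of m "4 ^ m", where ?'a = int] by (simp add: power_gt_expt)
    ultimately have "\<psi> m j = toeplitz j" if "\<bar>j\<bar> \<le> 2 * int r" for j
      unfolding \<psi>_def using that by (intro toeplitz_shift) linarith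
    then show "marked_sim r (nat_hall (\<psi> m), nat_hall_gens) (?G, nat_hall_gens)"
      by (intro marked_sim_hall) auto
  qed simp_all
  moreover have "finitely_generated ?G"
    unfolding finitely_generated_def
    by (intro exI[of _ "set nat_hall_gens"])
      (use nat_hall_generate[of toeplitz, OF toeplitz_one(1)] in \<open>auto simp: image_group_def\<close>)
  \<comment> \<open>The values at \<open>-1\<close>, \<open>0\<close>, \<open>1\<close> are
    \<open>1\<close>, \<open>0\<close>, \<open>1\<close>, so the second difference at
    \<open>0\<close> is \<open>2\<close>.\<close>
  moreover have "derived_length ?G = 3"
    by (rule nat_hall_derived_length) (simp add: toeplitz_one toeplitz_zero)
  ultimately show ?thesis
    using nat_hall_group nat_hall_solvable by blast
qed

end
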